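(* Let $(E,d)$ be a metric space satisfying the triangle equality. If the cardinality of $E$ is different from $4$, then $(E,d)$ is isometric to a subset of the real line (with the usual metric $|x-y|$). If $E$ has exactly $4$ points, then either $(E,d)$ can be isometrically embedded into the real line, or there exist real numbers $x>0$, $y>0$ with $x\neq y$ such that $(E,d)$ is isometric to the four-point space $\{A,B,C,D\}$ with distances $$d(A,B)=d(C,D)=x,\quad d(A,D)=d(B,C)=y,\quad d(A,C)=d(B,D)=|x-y|.$$
   Context: A metric space $(E,d)$ satisfies the triangle equality if for every three points $x,y,z\in E$ the largest of the numbers $d(x,y)$, $d(y,z)$, $d(z,x)$ equals the sum of the remaining two. *)

theory Defs
  imports "HOL-Analysis.Abstract_Metric_Spaces"
begin

definition largest_is_sum_of_others :: "real \<Rightarrow> real \<Rightarrow> real \<Rightarrow> bool" where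
  "largest_is_sum_of_others a b c \<longleftrightarrow>
     (b \<le> a \<and> c \<le> a \<and> a = b + c) \<or>
     (a \<le> b \<and> c \<le> b \<and> b = a + c) \<or>
     (a \<le> c \<and> b \<le> c \<and> c = a + b)"

text \<open>The points need not be distinct: in a metric space the condition holds
  automatically as soon as two of them coincide.\<close>

definition triangle_equality :: "'a set \<Rightarrow> ('a \<Rightarrow> 'a \<Rightarrow> real) \<Rightarrow> bool" where
  "triangle_equality E d \<longleftrightarrow>
     (\<forall>x\<in>E. \<forall>y\<in>E. \<forall>z\<in>E. largest_is_sum_of_others (d x y) (d y z) (d z x))"

definition isometric ::
    "'a set \<Rightarrow> ('a \<Rightarrow> 'a \<Rightarrow> real) \<Rightarrow> 'b set \<Rightarrow> ('b \<Rightarrow> 'b \<Rightarrow> real) \<Rightarrow> bool" where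
  "isometric E d E' d' \<longleftrightarrow>
     (\<exists>f. bij_betw f E E' \<and> (\<forall>x\<in>E. \<forall>y\<in>E. d' (f x) (f y) = d x y))"

definition isometric_to_subset_of_line :: "'a set \<Rightarrow> ('a \<Rightarrow> 'a \<Rightarrow> real) \<Rightarrow> bool" where
  "isometric_to_subset_of_line E d \<longleftrightarrow>
     (\<exists>S :: real set. isometric E d S (\<lambda>s t. \<bar>s - t\<bar>))"

datatype four_points = A | B | C | D

definition four_point_dist :: "real \<Rightarrow> real \<Rightarrow> four_points \<Rightarrow> four_points \<Rightarrow> real" where
  "four_point_dist x y p q =
     (if p = q then 0
      else if {p, q} = {A, B} \<or> {p, q} = {C, D} then x
      else if {p, q} = {A, D} \<or> {p, q} = {B, C} then y
      else \<bar>x - y\<bar>)"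

lemma Metric_space_four_point_dist:
  assumes "x > 0" "y > 0" "x \<noteq> y"
  shows "Metric_space {A, B, C, D} (four_point_dist x y)"
proof
  fix p q r :: four_points
  show "0 \<le> four_point_dist x y p q"
    using assms by (auto simp: four_point_dist_def)
  show "four_point_dist x y p q = four_point_dist x y q p"
    by (simp add: four_point_dist_def insert_commute eq_commute[of p q])
  show "four_point_dist x y p q = 0 \<longleftrightarrow> p = q"
    using assms by (auto simp: four_point_dist_def)
  show "four_point_dist x y p r \<le> four_point_dist x y p q + four_point_dist x y q r"
    using assms
    by (cases p; cases q; cases r) (auto simp: four_point_dist_def doubleton_eq_iff)
qed

end

theory Submission
  imports Defs
begin

text \<open>Two distinct base points \<open>a\<close>, \<open>b\<close> determine a unique candidate coordinate \<open>f\<close> with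
  \<open>\<bar>f z\<bar> = d a z\<close> and \<open>\<bar>f z - d a b\<bar> = d b z\<close>. Comparing the triples \<open>a, z, w\<close> and \<open>b, z, w\<close> shows
  that \<open>d z w = \<bar>f z - f w\<bar>\<close> unless \<open>f z + f w = d a b = d z w\<close>; in this exceptional case
  \<open>a, b, z, w\<close> form the four-point space. Its pairs of opposite distances are \<open>p\<close>, \<open>q\<close> and \<open>p + q\<close>
  for some positive \<open>p\<close>, \<open>q\<close>, and no fifth point can be added to it.\<close>

text \<open>The condition makes \<open>u\<close> either the sum or the distance of
  \<open>\<bar>p\<bar>\<close> and \<open>\<bar>q\<bar>\<close>; the signs decide which of these is
  \<open>\<bar>p + q\<bar>\<close> and which is \<open>\<bar>p - q\<bar>\<close>.\<close>

lemma largest_is_sum_of_others_absD: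
  assumes "largest_is_sum_of_others u \<bar>p\<bar> \<bar>q\<bar>"
  shows "u = \<bar>p - q\<bar> \<or> u = \<bar>p + q\<bar>"
proof -
  have "u = \<bar>p\<bar> + \<bar>q\<bar> \<or> \<bar>p\<bar> = u + \<bar>q\<bar> \<and> \<bar>q\<bar> \<le> \<bar>p\<bar> \<or> \<bar>q\<bar> = u + \<bar>p\<bar> \<and> \<bar>p\<bar> \<le> \<bar>q\<bar>"
    using assms unfolding largest_is_sum_of_others_def by auto
  then show ?thesis
    by linarith
qed

lemma isometric_to_subset_of_lineI:
  assumes "Metric_space E d"
    and "\<And>x y. x \<in> E \<Longrightarrow> y \<in> E \<Longrightarrow> \<bar>f x - f y\<bar> = d x y"
  shows "isometric_to_subset_of_line E d"
proof -
  have "inj_on f E"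
    using assms(2) Metric_space.zero[OF assms(1)] by (metis inj_onI)
  then show ?thesis
    unfolding isometric_to_subset_of_line_def isometric_def
    using assms(2) by (metis inj_on_imp_bij_betw)
qed

lemma isometric_four_pointsI:
  assumes "Metric_space {a, b, c, e} d" "distinct [a, b, c, e]"
    and "d a b = x" "d c e = x" "d a e = y" "d b c = y" "d a c = \<bar>x - y\<bar>" "d b e = \<bar>x - y\<bar>"
  shows "isometric {a, b, c, e} d {A, B, C, D} (four_point_dist x y)"
proof -
  interpret Metric_space "{a, b, c, e}" d by fact
  define f where "f z = (if z = a then A else if z = b then B else if z = c then C else D)" for z
  have "bij_betw f {a, b, c, e} {A, B, C, D}"
    using assms(2) unfolding bij_betw_def inj_on_def f_def by auto
  moreover have "four_point_dist x y (f z) (f w) = d z w"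
    if "z \<in> {a, b, c, e}" "w \<in> {a, b, c, e}" for z w
    using that assms(2-) commute
    by (auto simp: f_def four_point_dist_def doubleton_eq_iff)
  ultimately show ?thesis
    unfolding isometric_def by blast
qed

text \<open>Here \<open>r\<close>, \<open>s\<close>, \<open>t\<close>, \<open>u\<close> are the
  distances from a fifth point to the successive vertices of a 4-cycle with sides \<open>p\<close>,
  \<open>q\<close>, \<open>p\<close>, \<open>q\<close> and both diagonals \<open>p + q\<close>. Each
  triple gives three possible linear equations, and every combination contradicts
  positivity.\<close>

lemma no_fifth_point:
  fixes p q :: real
  assumes "p > 0" "q > 0" "r > 0" "s > 0" "t > 0" "u > 0"
    and "largest_is_sum_of_others p r s" "largest_is_sum_of_others p t u"
    and "largest_is_sum_of_others q s t" "largest_is_sum_of_others q r u"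
    and "largest_is_sum_of_others (p + q) r t" "largest_is_sum_of_others (p + q) s u"
  shows False
proof -
  have "p = r + s \<or> r = p + s \<or> s = p + r" "p = t + u \<or> t = p + u \<or> u = p + t"
    "q = s + t \<or> s = q + t \<or> t = q + s" "q = r + u \<or> r = q + u \<or> u = q + r"
    "p + q = r + t \<or> r = p + q + t \<or> t = p + q + r"
    "p + q = s + u \<or> s = p + q + u \<or> u = p + q + s"
    using assms(7-) unfolding largest_is_sum_of_others_def by auto
  then show False
    using assms(1-6) by (elim disjE; linarith)
qed

locale triangle_equality_space = Metric_space E d for E :: "'a set" and d +
  assumes triangle_equality: "triangle_equality E d"
begin

lemma largest_is_sum_of_others_dist:
  assumes "x \<in> E" "y \<in> E" "z \<in> E"
  shows "largest_is_sum_of_others (d x y) (d z x) (d z y)"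
  using assms triangle_equality unfolding triangle_equality_def
  by (metis commute)

text \<open>The four points sit like \<open>a\<close>, \<open>b\<close>, \<open>c\<close>,
  \<open>e\<close> in order on a circle of length \<open>2 * (p + q)\<close> with arc-length
  distance; \<open>a\<close>, \<open>c\<close> and \<open>b\<close>, \<open>e\<close> are
  antipodal.\<close>

lemma no_fifth_point_circular:
  assumes "{a, b, c, e, z} \<subseteq> E" "z \<notin> {a, b, c, e}" "p > 0" "q > 0"
    and "d a b = p" "d c e = p" "d b c = q" "d a e = q" "d a c = p + q" "d b e = p + q"
  shows False
proof -
  note * = largest_is_sum_of_others_dist[of _ _ z]
  have "d z a > 0" "d z b > 0" "d z c > 0" "d z e > 0"
    using assms(1,2) mdist_pos_less by auto
  moreover have "largest_is_sum_of_others p (d z a) (d z b)"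
    "largest_is_sum_of_others p (d z c) (d z e)" "largest_is_sum_of_others q (d z b) (d z c)"
    "largest_is_sum_of_others q (d z a) (d z e)"
    "largest_is_sum_of_others (p + q) (d z a) (d z c)"
    "largest_is_sum_of_others (p + q) (d z b) (d z e)"
    using assms(1) *[of a b] *[of c e] *[of b c] *[of a e] *[of a c] *[of b e]
    unfolding assms(5-) by simp_all
  ultimately show False
    using no_fifth_point assms(3,4) by blast
qed

lemma no_fifth_point_pseudolinear:
  assumes "{a, b, c, e, z} \<subseteq> E" "z \<notin> {a, b, c, e}" "x > 0" "y > 0" "x \<noteq> y"
    and "d a b = x" "d c e = x" "d a e = y" "d b c = y" "d a c = \<bar>x - y\<bar>" "d b e = \<bar>x - y\<bar>"
  shows False
proof (cases "x < y")
  case True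
  show False
    \<comment> \<open>The largest distance is now \<open>y = x + (y - x)\<close>, so the pairs at
      distance \<open>y\<close> must become the diagonals.\<close>
    by (rule no_fifth_point_circular[of a b e c z x "y - x"]) (use True assms commute in auto)
next
  case False
  show False
    by (rule no_fifth_point_circular[of a e b c z y "x - y"]) (use False assms commute in auto)
qed

lemma line_or_pseudolinear:
  assumes "\<not> isometric_to_subset_of_line E d"
  obtains a b c e x y where "{a, b, c, e} \<subseteq> E" "distinct [a, b, c, e]"
    "x > 0" "y > 0" "x \<noteq> y"
    "d a b = x" "d c e = x" "d a e = y" "d b c = y" "d a c = \<bar>x - y\<bar>" "d b e = \<bar>x - y\<bar>"
proof -
  \<comment> \<open>A constant map embeds a space with at most one point.\<close>
  obtain a b where ab: "a \<in> E" "b \<in> E" "a \<noteq> b"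
    using assms isometric_to_subset_of_lineI[OF Metric_space_axioms, of "\<lambda>_. 0"]
    by (metis abs_zero diff_self mdist_zero)
  define L where "L = d a b"
  have "L > 0" using ab mdist_pos_less L_def by simp
  \<comment> \<open>The coordinate puts \<open>a\<close> at 0 and \<open>b\<close> at
    \<open>L\<close>; it takes the negative sign when \<open>a\<close> lies between \<open>z\<close>
    and \<open>b\<close>.\<close>
  define f where "f z = (if d b z = L + d a z then - d a z else d a z)" for z
  have fa: "\<bar>f z\<bar> = d a z" for z
    by (simp add: f_def)
  have fb: "\<bar>f z - L\<bar> = d b z" if "z \<in> E" for z
  proof -
    have "largest_is_sum_of_others L (d a z) (d b z)"
      using largest_is_sum_of_others_dist[OF ab(1,2) that] by (simp add: L_def commute)
    then have "L = d a z + d b z \<or> d a z = L + d b z \<or> d b z = L + d a z"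
      unfolding largest_is_sum_of_others_def by blast
    then show ?thesis
      using \<open>L > 0\<close> nonneg[of a z] nonneg[of b z] unfolding f_def by (smt (verit))
  qed
  obtain z w where zw: "z \<in> E" "w \<in> E" "\<bar>f z - f w\<bar> \<noteq> d z w"
    using assms isometric_to_subset_of_lineI[OF Metric_space_axioms, of f] by blast
  have z: "\<bar>f z\<bar> = d a z" "\<bar>f z - L\<bar> = d b z" and w: "\<bar>f w\<bar> = d a w" "\<bar>f w - L\<bar> = d b w"
    using fa fb zw by auto
  have "largest_is_sum_of_others (d z w) \<bar>f z\<bar> \<bar>f w\<bar>"
    using largest_is_sum_of_others_dist[OF zw(1,2) ab(1)] z w by simp
  moreover have "largest_is_sum_of_others (d z w) \<bar>f z - L\<bar> \<bar>f w - L\<bar>"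
    using largest_is_sum_of_others_dist[OF zw(1,2) ab(2)] z w by simp
  \<comment> \<open>Shifting both coordinates by \<open>L\<close> keeps their difference, so the
    choice of \<open>z\<close> and \<open>w\<close> rules out the difference alternative in both
    triples.\<close>
  ultimately have "d z w = \<bar>f z + f w\<bar>" "d z w = \<bar>f z - L + (f w - L)\<bar>"
    using zw(3) by (auto dest!: largest_is_sum_of_others_absD)
  \<comment> \<open>The sum \<open>f z + f w\<close> is equally far from 0 and \<open>2 * L\<close>,
    hence equals \<open>L\<close>.\<close>
  then have zw_sum: "f z = L - f w" and zw_dist: "d z w = L"
    using \<open>L > 0\<close> by linarith+
  have "f w \<noteq> 0" "f w \<noteq> L"
    using zw(3) zw_sum zw_dist \<open>L > 0\<close> by auto
  moreover have "z \<noteq> w"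
    using zw(1) zw_dist \<open>L > 0\<close> by auto
  moreover have dists: "d a z = \<bar>L - f w\<bar>" "d b z = \<bar>f w\<bar>" "d a w = \<bar>f w\<bar>" "d b w = \<bar>L - f w\<bar>"
    using z w zw_sum by auto
  ultimately have distinct: "distinct [a, b, z, w]" "distinct [a, b, w, z]"
    using ab zw by auto
  show thesis
  \<comment> \<open>The parameter \<open>y\<close> is the distance from \<open>a\<close> to
    whichever of \<open>z\<close>, \<open>w\<close> has a positive coordinate chosen here:
    \<open>w\<close> if \<open>f w > 0\<close>, otherwise \<open>z\<close>.\<close>
  proof (cases "f w > 0")
    case True
    show thesis
    proof (rule that)
      show "{a, b, z, w} \<subseteq> E" using ab zw by simp
      show "d a b = L" "d z w = L" by (simp_all add: L_def zw_dist)
      show "d a w = f w" "d b z = f w" using dists True by simp_all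
    qed (fact distinct \<open>L > 0\<close> True dists \<open>f w \<noteq> L\<close>[symmetric])+
  next
    case False
    show thesis
    proof (rule that)
      show "{a, b, w, z} \<subseteq> E" using ab zw by simp
      show "d a b = L" "d w z = L" by (simp_all add: L_def zw_dist commute[of w z])
      show "L - f w > 0" "L \<noteq> L - f w" using False \<open>L > 0\<close> \<open>f w \<noteq> 0\<close> by simp_all
      show "d a z = L - f w" "d b w = L - f w" using dists False \<open>L > 0\<close> by simp_all
      show "d a w = \<bar>L - (L - f w)\<bar>" "d b z = \<bar>L - (L - f w)\<bar>" using dists by simp_all
    qed (fact distinct \<open>L > 0\<close>)+
  qed
qed

end

theorem theorem1p11:
  fixes E :: "'a set" and d :: "'a \<Rightarrow> 'a \<Rightarrow> real"
  assumes "Metric_space E d"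
    and "triangle_equality E d"
  shows "(card E \<noteq> 4 \<longrightarrow> isometric_to_subset_of_line E d) \<and>
         (card E = 4 \<longrightarrow>
            isometric_to_subset_of_line E d \<or>
            (\<exists>x y :: real. x > 0 \<and> y > 0 \<and> x \<noteq> y \<and>
               isometric E d {A, B, C, D} (four_point_dist x y)))"
proof (cases "isometric_to_subset_of_line E d")
  case False
  interpret triangle_equality_space E d
    using assms by (simp add: triangle_equality_space_def triangle_equality_space_axioms_def)
  obtain a b c e x y where sub: "{a, b, c, e} \<subseteq> E" and dist: "distinct [a, b, c, e]"
    and xy: "x > 0" "y > 0" "x \<noteq> y"
    and d: "d a b = x" "d c e = x" "d a e = y" "d b c = y" "d a c = \<bar>x - y\<bar>" "d b e = \<bar>x - y\<bar>"
    using line_or_pseudolinear[OF False] by blast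
  \<comment> \<open>Failure to embed thus forces exactly four points, which settles both cardinality
    cases.\<close>
  have E: "E = {a, b, c, e}"
    using no_fifth_point_pseudolinear[of a b c e _ x y] sub xy d by blast
  then have "card E = 4"
    using dist by simp
  moreover have "isometric E d {A, B, C, D} (four_point_dist x y)"
    using isometric_four_pointsI[of a b c e d x y] Metric_space_axioms dist d E by simp
  ultimately show ?thesis
    using xy by auto
qed simp

end
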